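(* The discrete mimetic finite-difference flux operators $$\mathcal J^0_D=E_{\boldsymbol e^D}^{-1}\mathcal D_{\boldsymbol e^D}^{-1}\mathcal G E_{\boldsymbol x^D},\qquad \mathcal J^1_D=E_{\partial D}^{-1}\mathcal D_{\partial D}^{-1}\mathcal K\mathcal D_{\boldsymbol e^D}E_{\boldsymbol e^D},\qquad \mathcal J^2_V=E_D^{-1}\mathcal D_D^{-1}\mathcal G_V^T\mathcal D_{\partial D}E_{\partial D}$$ satisfy $\mathcal J^1_D\mathcal J^0_D=0$ and $\mathcal J^2_V\mathcal J^1_D=0$, i.e., they form a sequence $$H_D\xrightarrow{\ \mathcal J^0_D\ }\boldsymbol H_{\boldsymbol D}\xrightarrow{\ \mathcal J^1_D\ }\boldsymbol H_{\boldsymbol V}\xrightarrow{\ \mathcal J^2_V\ }H_V$$ in which consecutive maps compose to zero. This holds regardless of how the exponential integrals defining the diagonal matrices $E_{\boldsymbol e^D}$, $E_{\partial D}$, $E_D$ are computed (i.e., when they are replaced by invertible diagonal quadrature approximations), so long as the same approximation is used consistently in the three operators.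
   Context: A simplicial (Delaunay) primal mesh of a bounded polyhedral domain $\Omega\subset\mathbb R^3$ is given, with nodes $\boldsymbol x^D_i$, edges $\boldsymbol e^D_{ij}$ with unit tangent $\boldsymbol t^D_{ij}$ pointing from lower to higher node index, faces $\partial D_{km}$ and elements $D_k$; the dual (Voronoi) mesh has one cell per primal node, one face per primal edge, one edge $\boldsymbol e^V_{km}$ (with unit tangent $\boldsymbol t^V_{km}$ normal to $\partial D_{km}$, which orients that face) per primal face, and one node per primal element. The spaces $H_D,\boldsymbol H_{\boldsymbol D},\boldsymbol H_{\boldsymbol V},H_V$ of discrete functions are identified with the spaces of real vectors indexed by primal nodes, primal edges, dual edges (equivalently primal faces), and dual nodes (equivalently primal elements), respectively. Incidence matrices: $\mathcal G$ (edges by nodes) has in the row of $\boldsymbol e^D_{ij}$, $i<j$, entries $-1$ in column $i$ and $+1$ in column $j$; $\mathcal K$ (faces by edges) has entry $\pm1$ if the edge lies on the boundary of the face, $+1$ exactly when $\boldsymbol t^D_{ij}$ is positively oriented (right-hand rule) with respect to the face normal $\boldsymbol t^V_{km}$, and $0$ otherwise; $\mathcal G_V$ (dual edges by dual nodes) is the signed incidence matrix whose entry for face $\partial D_{km}$ and element $D_k$ having this face is $\pm1$ according to whether the unit normal pointing outward from $D_k$ agrees with the chosen orientation of the face (up to one global sign convention), and $0$ otherwise. Diagonal matrices: $\mathcal D_{\boldsymbol e^D}=\operatorname{diag}(|\boldsymbol e^D_{ij}|)$, $\mathcal D_{\partial D}=\operatorname{diag}(|\partial D_{km}|)$, $\mathcal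 D_D=\operatorname{diag}(|D_k|)$; for a potential $\varphi$ on $\Omega$ (with $\operatorname{grad}\varphi=\boldsymbol\theta=\boldsymbol\beta/\alpha$, the ratio of convection to diffusion coefficients), $E_{\boldsymbol x^D}=\operatorname{diag}(e^{\varphi(\boldsymbol x^D_i)})$, $E_{\boldsymbol e^D}=\operatorname{diag}\big(⨍_{\boldsymbol e^D_{ij}}e^\varphi ds\big)$, $E_{\partial D}=\operatorname{diag}\big(⨍_{\partial D_{km}}e^\varphi dA\big)$, $E_D=\operatorname{diag}\big(⨍_{D_k}e^\varphi dV\big)$, where $⨍$ denotes the average integral. *)

theory Defs
  imports "HOL-Analysis.Analysis"
begin

section \<open>Delaunay meshes with their Voronoi orientation data\<close>

text \<open>
  A mesh is indexed by four finite types: nodes (linearly ordered, since edges point from lower to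
  higher node index), edges, faces and elements. By duality the same types index the Voronoi
  cells, the Voronoi faces, the Voronoi edges and the Voronoi nodes, respectively, so that the
  spaces of discrete functions are \<open>real^'n\<close>, \<open>real^'e\<close>, \<open>real^'f\<close> and \<open>real^'c\<close>. An edge, face or
  element is recorded by its set of vertices.

  The field \<open>dual_tangent\<close> gives the unit tangent of the Voronoi edge crossing a face. That edge lies
  on the line through the circumcentres, which is normal to the face, so the tangent is
  determined up to sign, and the sign orients the face. It is stored as a unit normal, because
  circumcentres of neighbouring elements may coincide and boundary faces have only one neighbour.
\<close>

record ('n, 'e, 'f, 'c) mesh =
  node :: "'n \<Rightarrow> real^3"
  edge :: "'e \<Rightarrow> 'n set"
  face :: "'f \<Rightarrow> 'n set"
  elem :: "'c \<Rightarrow> 'n set"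
  dual_tangent :: "'f \<Rightarrow> real^3"

definition elem_set :: "('n, 'e, 'f, 'c) mesh \<Rightarrow> 'c \<Rightarrow> (real^3) set" where
  "elem_set M c = convex hull (node M ` elem M c)"

text \<open>The domain need not be convex, Lipschitz or simply connected.\<close>

definition bounded_polyhedral_domain :: "(real^3) set \<Rightarrow> bool" where
  "bounded_polyhedral_domain \<Omega> \<longleftrightarrow>
     open \<Omega> \<and> connected \<Omega> \<and> \<Omega> \<noteq> {} \<and> bounded \<Omega> \<and>
     (\<exists>P. finite P \<and> (\<forall>p\<in>P. polytope p) \<and> frontier \<Omega> = \<Union>P)"

definition delaunay :: "('n, 'e, 'f, 'c) mesh \<Rightarrow> bool" where
  "delaunay M \<longleftrightarrow>
     (\<forall>c. \<exists>z r. (\<forall>i \<in> elem M c. dist (node M i) z = r) \<and> (\<forall>j. r \<le> dist (node M j) z))"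

definition is_unit_normal :: "('n, 'e, 'f, 'c) mesh \<Rightarrow> 'f \<Rightarrow> real^3 \<Rightarrow> bool" where
  "is_unit_normal M f \<nu> \<longleftrightarrow>
     norm \<nu> = 1 \<and> (\<forall>i \<in> face M f. \<forall>j \<in> face M f. \<nu> \<bullet> (node M i - node M j) = 0)"

definition delaunay_mesh ::
    "(real^3) set \<Rightarrow> ('n::{finite,linorder}, 'e::finite, 'f::finite, 'c::finite) mesh \<Rightarrow> bool" where
  "delaunay_mesh \<Omega> M \<longleftrightarrow>
     bounded_polyhedral_domain \<Omega> \<and>
     inj (node M) \<and> (\<Union>c. elem M c) = UNIV \<and>
     inj (elem M) \<and> (\<forall>c. card (elem M c) = 4 \<and> \<not> affine_dependent (node M ` elem M c)) \<and>
     triangulation (range (elem_set M)) \<and> (\<Union>c. elem_set M c) = closure \<Omega> \<and>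
     bij_betw (edge M) UNIV {s. card s = 2 \<and> (\<exists>c. s \<subseteq> elem M c)} \<and>
     bij_betw (face M) UNIV {s. card s = 3 \<and> (\<exists>c. s \<subseteq> elem M c)} \<and>
     delaunay M \<and>
     (\<forall>f. is_unit_normal M f (dual_tangent M f))"

section \<open>Incidence matrices\<close>

definition edge_tail :: "('n::{finite,linorder}, 'e, 'f, 'c) mesh \<Rightarrow> 'e \<Rightarrow> 'n" where
  "edge_tail M e = Min (edge M e)"

definition edge_head :: "('n::{finite,linorder}, 'e, 'f, 'c) mesh \<Rightarrow> 'e \<Rightarrow> 'n" where
  "edge_head M e = Max (edge M e)"

definition edge_length :: "('n::{finite,linorder}, 'e, 'f, 'c) mesh \<Rightarrow> 'e \<Rightarrow> real" where
  "edge_length M e = dist (node M (edge_tail M e)) (node M (edge_head M e))"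

definition edge_tangent :: "('n::{finite,linorder}, 'e, 'f, 'c) mesh \<Rightarrow> 'e \<Rightarrow> real^3" where
  "edge_tangent M e = (node M (edge_head M e) - node M (edge_tail M e)) /\<^sub>R edge_length M e"

definition grad_mat ::
    "('n::{finite,linorder}, 'e::finite, 'f, 'c) mesh
      \<Rightarrow> real^('n::{finite,linorder})^'e" where
  "grad_mat M = (\<chi> e i. if i = edge_tail M e then -1 else if i = edge_head M e then 1 else 0)"

text \<open>
  Right-hand rule: with the dual tangent pointing at the viewer, the edge runs counterclockwise
  around the face, i.e. the face lies to its left, in direction (dual tangent) x (edge tangent).
\<close>

definition positively_oriented ::
    "('n::{finite,linorder}, 'e, 'f, 'c) mesh \<Rightarrow> 'f \<Rightarrow> 'e \<Rightarrow> bool" where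
  "positively_oriented M f e \<longleftrightarrow>
     (\<forall>k \<in> face M f - edge M e.
        cross3 (dual_tangent M f) (edge_tangent M e) \<bullet> (node M k - node M (edge_tail M e)) > 0)"

definition curl_mat ::
    "('n::{finite,linorder}, 'e::finite, 'f::finite, 'c) mesh \<Rightarrow> real^'e^'f" where
  "curl_mat M = (\<chi> f e. if edge M e \<subseteq> face M f
                         then (if positively_oriented M f e then 1 else -1) else 0)"

definition is_outward_unit_normal ::
    "('n, 'e, 'f, 'c) mesh \<Rightarrow> 'c \<Rightarrow> 'f \<Rightarrow> real^3 \<Rightarrow> bool" where
  "is_outward_unit_normal M c f \<nu> \<longleftrightarrow>
     is_unit_normal M f \<nu> \<and>
     (\<forall>i \<in> elem M c - face M f. \<forall>j \<in> face M f. \<nu> \<bullet> (node M i - node M j) < 0)"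

text \<open>The parameter \<open>\<sigma>\<close>, which is \<open>1\<close> or \<open>-1\<close>, is the global sign convention.\<close>

definition dual_grad_mat ::
    "real \<Rightarrow> ('n, 'e, 'f::finite, 'c::finite) mesh \<Rightarrow> real^'c^'f" where
  "dual_grad_mat \<sigma> M = (\<chi> f c. if face M f \<subseteq> elem M c
       then (if is_outward_unit_normal M c f (dual_tangent M f) then \<sigma> else - \<sigma>) else 0)"

section \<open>Measures and averages\<close>

definition edge_integral ::
    "('n::{finite,linorder}, 'e, 'f, 'c) mesh \<Rightarrow> (real^3 \<Rightarrow> real) \<Rightarrow> 'e \<Rightarrow> real" where
  "edge_integral M g e =
     (LINT t:{0..1}|lborel.
        g (linepath (node M (edge_tail M e)) (node M (edge_head M e)) t) * edge_length M e)"

definition face_vertex ::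
    "('n::{finite,linorder}, 'e, 'f, 'c) mesh \<Rightarrow> 'f \<Rightarrow> nat \<Rightarrow> real^3" where
  "face_vertex M f k = node M (sorted_list_of_set (face M f) ! k)"

text \<open>Surface integral through the affine parametrization of the triangle.\<close>

definition face_integral ::
    "('n::{finite,linorder}, 'e, 'f, 'c) mesh \<Rightarrow> (real^3 \<Rightarrow> real) \<Rightarrow> 'f \<Rightarrow> real" where
  "face_integral M g f =
     (let a = face_vertex M f 0;
          u = face_vertex M f 1 - a;
          v = face_vertex M f 2 - a
      in LINT p:{(s, t). 0 \<le> s \<and> 0 \<le> t \<and> s + t \<le> 1}|lborel.
           g (a + fst p *\<^sub>R u + snd p *\<^sub>R v) * norm (cross3 u v))"

definition face_area :: "('n::{finite,linorder}, 'e, 'f, 'c) mesh \<Rightarrow> 'f \<Rightarrow> real" where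
  "face_area M f = face_integral M (\<lambda>_. 1) f"

definition elem_volume :: "('n, 'e, 'f, 'c) mesh \<Rightarrow> 'c \<Rightarrow> real" where
  "elem_volume M c = measure lborel (elem_set M c)"

definition edge_average ::
    "('n::{finite,linorder}, 'e, 'f, 'c) mesh \<Rightarrow> (real^3 \<Rightarrow> real) \<Rightarrow> 'e \<Rightarrow> real" where
  "edge_average M g e = edge_integral M g e / edge_length M e"

definition face_average ::
    "('n::{finite,linorder}, 'e, 'f, 'c) mesh \<Rightarrow> (real^3 \<Rightarrow> real) \<Rightarrow> 'f \<Rightarrow> real" where
  "face_average M g f = face_integral M g f / face_area M f"

definition elem_average :: "('n, 'e, 'f, 'c) mesh \<Rightarrow> (real^3 \<Rightarrow> real) \<Rightarrow> 'c \<Rightarrow> real" where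
  "elem_average M g c = (LINT y:elem_set M c|lborel. g y) / elem_volume M c"

section \<open>Diagonal matrices and flux operators\<close>

definition diag_mat :: "('i::finite \<Rightarrow> real) \<Rightarrow> real^'i^'i" where
  "diag_mat d = (\<chi> i j. if i = j then d i else 0)"

definition E_node :: "('n::finite, 'e, 'f, 'c) mesh \<Rightarrow> (real^3 \<Rightarrow> real) \<Rightarrow> real^'n^'n" where
  "E_node M \<phi> = diag_mat (\<lambda>i. exp (\<phi> (node M i)))"

definition E_edge ::
    "('n::{finite,linorder}, 'e::finite, 'f, 'c) mesh \<Rightarrow> (real^3 \<Rightarrow> real) \<Rightarrow> real^'e^'e" where
  "E_edge M \<phi> = diag_mat (edge_average M (\<lambda>y. exp (\<phi> y)))"

definition E_face ::
    "('n::{finite,linorder}, 'e, 'f::finite, 'c) mesh \<Rightarrow> (real^3 \<Rightarrow> real) \<Rightarrow> real^'f^'f" where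
  "E_face M \<phi> = diag_mat (face_average M (\<lambda>y. exp (\<phi> y)))"

definition E_elem ::
    "('n, 'e, 'f, 'c::finite) mesh \<Rightarrow> (real^3 \<Rightarrow> real) \<Rightarrow> real^'c^'c" where
  "E_elem M \<phi> = diag_mat (elem_average M (\<lambda>y. exp (\<phi> y)))"

text \<open>
  The flux operators take the diagonal matrices of exponential averages as arguments, so that the
  exact averages and any approximations of them can be plugged in.
\<close>

definition flux0 ::
    "('n::{finite,linorder}, 'e::finite, 'f, 'c) mesh
      \<Rightarrow> real^('n::{finite,linorder})^('n::{finite,linorder}) \<Rightarrow> real^'e^'e
      \<Rightarrow> real^('n::{finite,linorder})^'e" where
  "flux0 M En Ee =
     matrix_inv Ee ** matrix_inv (diag_mat (edge_length M)) ** grad_mat M ** En"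

definition flux1 ::
    "('n::{finite,linorder}, 'e::finite, 'f::finite, 'c) mesh \<Rightarrow> real^'e^'e \<Rightarrow> real^'f^'f
      \<Rightarrow> real^'e^'f" where
  "flux1 M Ee Ef =
     matrix_inv Ef ** matrix_inv (diag_mat (face_area M)) ** curl_mat M
       ** diag_mat (edge_length M) ** Ee"

definition flux2 ::
    "real \<Rightarrow> ('n::{finite,linorder}, 'e, 'f::finite, 'c::finite) mesh \<Rightarrow> real^'f^'f
      \<Rightarrow> real^'c^'c \<Rightarrow> real^'f^'c" where
  "flux2 \<sigma> M Ef Ec =
     matrix_inv Ec ** matrix_inv (diag_mat (elem_volume M)) ** transpose (dual_grad_mat \<sigma> M)
       ** diag_mat (face_area M) ** Ef"

end

theory Submission
  imports Defs
begin

text \<open>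
  In the products of consecutive flux operators the inner diagonal factors cancel: the lengths and
  edge averages stand next to their own inverses, likewise the areas and face averages. What remains
  between the outer diagonal factors is a product of incidence matrices, \<open>K G\<close> or \<open>G\<^sub>V\<^sup>T K\<close>. This is
  why only consistency and invertibility of the averages matter, not how they are computed. For the
  exact averages of \<open>exp \<circ> \<phi>\<close> invertibility is positivity of an integral of a positive
  continuous function over a nondegenerate segment or triangle
  (\<open>edge_integral_pos\<close>, \<open>face_integral_pos\<close>).

  That the incidence matrices compose to zero is the identity "the boundary of a boundary vanishes"
  on a single simplex, but their signs are here given geometrically, by unit normals and the
  right-hand rule. They are first turned into signs of triple products. In \<open>K G\<close> (\<open>curl_grad_zero\<close>)
  a corner of a triangle lies on two of its edges, and the two terms carry the sign of the signed
  area with the other two corners interchanged. In \<open>G\<^sub>V\<^sup>T K\<close> (\<open>dual_grad_curl_zero\<close>) an edge of a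
  tetrahedron lies on two of its faces; the unit normal \<open>\<nu>\<close> of a face enters twice, once through
  "outward" and once through the right-hand rule. Since \<open>\<nu>\<close> is parallel to
  \<open>w = (b - a) \<times> (p - a)\<close> and has length one, \<open>(\<nu> \<bullet> w) (\<nu> \<bullet> (q - a)) = w \<bullet> (q - a)\<close>
  (\<open>orient_times_height\<close>), so each term is, up to a common factor, the sign of the signed volume,
  which changes when \<open>p\<close> and \<open>q\<close> are interchanged. None of these products is zero, by affine independence of the vertices
  (\<open>affine_independent_triple_product\<close>); this matters because the incidence matrices have a
  nonzero entry, unlike \<open>sgn\<close>, also where such a product would vanish.
\<close>

section \<open>Diagonal matrices\<close>

lemma matrix_mul_matrix_inv:
  fixes A :: "real^'n^'n"
  assumes "invertible A"
  shows "A ** matrix_inv A = mat 1"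
proof -
  have "\<exists>B. A ** B = mat 1 \<and> B ** A = mat 1"
    using assms by (simp add: invertible_def)
  then have "A ** matrix_inv A = mat 1 \<and> matrix_inv A ** A = mat 1"
    unfolding matrix_inv_def by (rule someI_ex)
  then show ?thesis ..
qed

lemma diag_mat_mult: "diag_mat a ** diag_mat b = diag_mat (\<lambda>i. a i * b i)"
proof -
  have "(\<Sum>k\<in>UNIV. (if i = k then a i else 0) * (if k = j then b k else 0))
      = (if i = j then a i * b i else 0)" for i j :: 'a
  proof -
    have "(\<Sum>k\<in>UNIV. (if i = k then a i else 0) * (if k = j then b k else 0))
        = (\<Sum>k\<in>UNIV. if k = i then (if i = j then a i * b i else 0) else 0)"
      by (rule sum.cong) auto
    then show ?thesis by simp
  qed
  then show ?thesis
    by (simp add: diag_mat_def matrix_matrix_mult_def vec_eq_iff)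
qed

lemma invertible_diag_mat:
  assumes "\<And>i. d i \<noteq> 0"
  shows "invertible (diag_mat d)"
  unfolding invertible_def
proof (intro exI conjI)
  show "diag_mat d ** diag_mat (\<lambda>i. inverse (d i)) = mat 1"
    using assms by (simp add: diag_mat_mult) (simp add: diag_mat_def mat_def)
  show "diag_mat (\<lambda>i. inverse (d i)) ** diag_mat d = mat 1"
    using assms by (simp add: diag_mat_mult) (simp add: diag_mat_def mat_def)
qed

section \<open>Triple products and orientation\<close>

lemma triple_product_swap: "cross3 u v \<bullet> w = - (cross3 u w \<bullet> v)"
  by (simp add: cross3_simps)

lemma cross3_eq_scaleR_unit_normal:
  assumes "norm \<nu> = 1" "\<nu> \<bullet> u = 0" "\<nu> \<bullet> v = 0"
  shows "cross3 u v = (\<nu> \<bullet> cross3 u v) *\<^sub>R \<nu>"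
proof -
  have "cross3 \<nu> (cross3 u v) = 0"
    using assms by (simp add: Lagrange)
  then have "cross3 \<nu> (cross3 \<nu> (cross3 u v)) = 0"
    by simp
  moreover have "\<nu> \<bullet> \<nu> = 1"
    using assms(1) by (simp add: norm_eq_1)
  ultimately show ?thesis
    by (simp add: Lagrange[of \<nu> \<nu>])
qed

text \<open>
  A vector orthogonal to the three difference vectors is orthogonal to their span, which is the
  whole space; hence the matrix with these rows has trivial kernel.
\<close>

lemma affine_independent_triple_product:
  fixes a b p q :: "real^3"
  assumes card: "card {a, b, p, q} = 4" and indep: "\<not> affine_dependent {a, b, p, q}"
  shows "cross3 (b - a) (p - a) \<bullet> (q - a) \<noteq> 0"
proof
  assume 0: "cross3 (b - a) (p - a) \<bullet> (q - a) = 0"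
  let ?S = "(\<lambda>x. x - a) ` {a, b, p, q}"
  have "dim ?S = 3"
    using affine_independent_card_dim_diffs[OF indep, of a] card by simp
  then have span: "span ?S = UNIV"
    using dim_eq_full[of ?S] by simp
  have "det (vector [q - a, b - a, p - a] :: real^3^3) = 0"
    using 0 by (simp add: inner_commute flip: dot_cross_det)
  then obtain x where x: "x \<noteq> 0" "(vector [q - a, b - a, p - a] :: real^3^3) *v x = 0"
    using invertible_det_nz invertible_left_inverse matrix_left_invertible_ker by metis
  then have "\<forall>i. row i (vector [q - a, b - a, p - a] :: real^3^3) \<bullet> x = 0"
    by (metis matrix_vector_mul_component row_def vec_lambda_eta zero_index)
  then have "(q - a) \<bullet> x = 0" "(b - a) \<bullet> x = 0" "(p - a) \<bullet> x = 0"
    by (simp_all add: forall_3 row_def vec_lambda_eta)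
  then have "\<And>y. y \<in> ?S \<Longrightarrow> orthogonal x y"
    by (auto simp: orthogonal_def inner_commute)
  then have "orthogonal x x"
    using orthogonal_to_span[of x ?S x] span by auto
  with x(1) show False
    by (simp add: orthogonal_def)
qed

section \<open>Combinatorics of the mesh\<close>

lemma range_edge: "delaunay_mesh \<Omega> M \<Longrightarrow>
    range (edge M) = {s. card s = 2 \<and> (\<exists>c. s \<subseteq> elem M c)}"
  and range_face: "delaunay_mesh \<Omega> M \<Longrightarrow>
    range (face M) = {s. card s = 3 \<and> (\<exists>c. s \<subseteq> elem M c)}"
  by (simp_all add: delaunay_mesh_def bij_betw_def)

lemma edge_vertices:
  assumes "delaunay_mesh \<Omega> M"
  shows "edge M e = {edge_tail M e, edge_head M e}" "edge_tail M e < edge_head M e"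
proof -
  have "edge M e \<in> {s. card s = 2 \<and> (\<exists>c. s \<subseteq> elem M c)}"
    using range_edge[OF assms] by blast
  then obtain i j where ij: "edge M e = {i, j}" "i \<noteq> j"
    by (auto simp: card_2_iff)
  then have "edge M e = {edge_tail M e, edge_head M e} \<and> edge_tail M e < edge_head M e"
    by (auto simp: edge_tail_def edge_head_def min_def max_def)
  then show "edge M e = {edge_tail M e, edge_head M e}" "edge_tail M e < edge_head M e"
    by auto
qed

lemma edge_length_pos:
  assumes "delaunay_mesh \<Omega> M"
  shows "edge_length M e > 0"
proof -
  have "inj (node M)"
    using assms by (simp add: delaunay_mesh_def)
  then show ?thesis
    using edge_vertices(2)[OF assms, of e] by (auto simp: edge_length_def inj_eq)
qed

lemma elem_contains_edge:
  assumes "delaunay_mesh \<Omega> M"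
  obtains c where "edge M e \<subseteq> elem M c"
proof -
  have "edge M e \<in> {s. card s = 2 \<and> (\<exists>c. s \<subseteq> elem M c)}"
    using range_edge[OF assms] by blast
  with that show ?thesis by blast
qed

lemma face_in_elem:
  assumes "delaunay_mesh \<Omega> M"
  obtains c where "face M f \<subseteq> elem M c" "card (face M f) = 3"
proof -
  have "face M f \<in> {s. card s = 3 \<and> (\<exists>c. s \<subseteq> elem M c)}"
    using range_face[OF assms] by blast
  with that show ?thesis by blast
qed

lemma edge_index:
  assumes "delaunay_mesh \<Omega> M" "i \<noteq> j" "{i, j} \<subseteq> elem M c"
  obtains e where "edge M e = {i, j}"
proof -
  have "card {i, j} = 2"
    using assms by simp
  then have "{i, j} \<in> {s. card s = 2 \<and> (\<exists>c. s \<subseteq> elem M c)}"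
    using assms(3) by blast
  then have "{i, j} \<in> range (edge M)"
    by (simp only: range_edge[OF assms(1)])
  with that show ?thesis by (metis rangeE)
qed

lemma face_index:
  assumes "delaunay_mesh \<Omega> M" "i \<noteq> j" "i \<noteq> k" "j \<noteq> k" "{i, j, k} \<subseteq> elem M c"
  obtains f where "face M f = {i, j, k}"
proof -
  have "card {i, j, k} = 3"
    using assms by simp
  then have "{i, j, k} \<in> {s. card s = 3 \<and> (\<exists>c. s \<subseteq> elem M c)}"
    using assms(5) by blast
  then have "{i, j, k} \<in> range (face M)"
    by (simp only: range_face[OF assms(1)])
  with that show ?thesis by (metis rangeE)
qed

lemma inj_edge: "delaunay_mesh \<Omega> M \<Longrightarrow> inj (edge M)"
  and inj_face: "delaunay_mesh \<Omega> M \<Longrightarrow> inj (face M)"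
  by (auto simp: delaunay_mesh_def bij_betw_def)

lemma sum_eq_two_terms:
  fixes g :: "'i::finite \<Rightarrow> real"
  assumes "x \<noteq> y" "\<And>i. i \<noteq> x \<Longrightarrow> i \<noteq> y \<Longrightarrow> g i = 0"
  shows "sum g UNIV = g x + g y"
proof -
  have "sum g UNIV = sum g {x, y}"
    using assms by (intro sum.mono_neutral_right) auto
  then show ?thesis using assms(1) by simp
qed

lemma card_3_with_element:
  assumes "card S = 3" "a \<in> S"
  obtains b c where "S = {a, b, c}" "a \<noteq> b" "a \<noteq> c" "b \<noteq> c"
proof -
  obtain x y z where "S = {x, y, z}" "x \<noteq> y" "y \<noteq> z" "x \<noteq> z"
    using assms(1) by (auto simp: card_3_iff)
  moreover have "a = x \<or> a = y \<or> a = z"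
    using calculation(1) assms(2) by auto
  ultimately show ?thesis
    using that[of y z] that[of x z] that[of x y] by (elim disjE) (auto simp: insert_commute)
qed

lemma elem_triple_product:
  assumes mesh: "delaunay_mesh \<Omega> M" and c: "elem M c = {a, b, p, q}"
  shows "cross3 (node M b - node M a) (node M p - node M a) \<bullet> (node M q - node M a) \<noteq> 0"
proof -
  have "inj (node M)" "card (elem M c) = 4" "\<not> affine_dependent (node M ` elem M c)"
    using mesh by (auto simp: delaunay_mesh_def)
  moreover have "card (node M ` elem M c) = card (elem M c)"
    using calculation(1) by (intro card_image) (auto simp: inj_def inj_on_def)
  ultimately show ?thesis
    using affine_independent_triple_product by (simp add: c)
qed

section \<open>The incidence matrices form a complex\<close>

text \<open>
  The number whose sign the right-hand rule reads off: it is twice the signed area of the triangle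
  with corners \<open>a\<close>, \<open>b\<close>, \<open>k\<close> in the plane of the face oriented by the dual tangent.
\<close>

definition orient :: "('n, 'e, 'f, 'c) mesh \<Rightarrow> 'f \<Rightarrow> 'n \<Rightarrow> 'n \<Rightarrow> 'n \<Rightarrow> real" where
  "orient M f a b k =
     dual_tangent M f \<bullet> cross3 (node M b - node M a) (node M k - node M a)"

lemma orient_swap: "orient M f b a k = - orient M f a b k"
  and orient_swap': "orient M f a k b = - orient M f a b k"
  by (simp_all add: orient_def cross3_simps)

text \<open>
  The dual tangent is one of the two unit normals of the plane spanned by the edge vectors, so it
  enters twice with the same unknown sign, and the product is independent of that sign.
\<close>

lemma orient_times_height:
  assumes mesh: "delaunay_mesh \<Omega> M" and f: "{a, b, p} \<subseteq> face M f"
  shows "orient M f a b p * (dual_tangent M f \<bullet> (x - node M a))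
       = cross3 (node M b - node M a) (node M p - node M a) \<bullet> (x - node M a)"
proof -
  have \<nu>: "is_unit_normal M f (dual_tangent M f)"
    using mesh by (auto simp: delaunay_mesh_def)
  have "cross3 (node M b - node M a) (node M p - node M a)
      = orient M f a b p *\<^sub>R dual_tangent M f"
    using \<nu> f unfolding orient_def
    by (intro cross3_eq_scaleR_unit_normal) (auto simp: is_unit_normal_def)
  then show ?thesis by simp
qed

text \<open>
  Affine independence is known for the vertices of an element only; the fourth vertex of an element
  containing the face turns it into nondegeneracy of the face.
\<close>

lemma orient_nonzero:
  assumes mesh: "delaunay_mesh \<Omega> M" and f: "face M f = {a, b, p}"
  shows "orient M f a b p \<noteq> 0"
proof -
  obtain c where c: "face M f \<subseteq> elem M c" "card (face M f) = 3"
    using face_in_elem[OF mesh] .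
  have "card (elem M c) = 4"
    using mesh by (simp add: delaunay_mesh_def)
  with c have "card (elem M c - face M f) = 1"
    by (simp add: card_Diff_subset)
  then obtain q where "elem M c - face M f = {q}"
    by (auto simp: card_1_singleton_iff)
  with c(1) f have "elem M c = {a, b, p, q}"
    by auto
  then show ?thesis
    using elem_triple_product[OF mesh] orient_times_height[OF mesh, of a b p f "node M q"] f by auto
qed

lemma curl_mat_eq_sgn:
  assumes mesh: "delaunay_mesh \<Omega> M"
    and f: "face M f = {edge_tail M e, edge_head M e, k}"
    and k: "k \<noteq> edge_tail M e" "k \<noteq> edge_head M e"
  shows "curl_mat M $ f $ e = sgn (orient M f (edge_tail M e) (edge_head M e) k)"
proof -
  have e: "edge M e = {edge_tail M e, edge_head M e}"
    using edge_vertices[OF mesh] by blast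
  have "face M f - edge M e = {k}"
    unfolding f using e k by auto
  then have "positively_oriented M f e \<longleftrightarrow>
      cross3 (dual_tangent M f) (edge_tangent M e) \<bullet> (node M k - node M (edge_tail M e)) > 0"
    by (simp add: positively_oriented_def)
  also have "cross3 (dual_tangent M f) (edge_tangent M e) \<bullet> (node M k - node M (edge_tail M e))
      = orient M f (edge_tail M e) (edge_head M e) k / edge_length M e"
    by (simp add: edge_tangent_def orient_def cross_mult_right divide_inverse_commute
        cross_triple[of "dual_tangent M f"] inner_commute[of "dual_tangent M f"])
  also have "\<dots> > 0 \<longleftrightarrow> orient M f (edge_tail M e) (edge_head M e) k > 0"
    using edge_length_pos[OF mesh, of e] by (simp add: zero_less_divide_iff)
  finally show ?thesis
    using orient_nonzero[OF mesh f] e f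
    by (auto simp: curl_mat_def sgn_if)
qed

text \<open>
  Reversing an edge changes both its incidence with an end point and its orientation along the
  face, so the product depends only on the end point \<open>i\<close> and not on the ordering of the nodes.
\<close>

lemma curl_grad_term:
  assumes mesh: "delaunay_mesh \<Omega> M"
    and f: "face M f = {i, j, k}" and ne: "i \<noteq> j" "i \<noteq> k" "j \<noteq> k" and e: "edge M e = {i, j}"
  shows "curl_mat M $ f $ e * grad_mat M $ e $ i = - sgn (orient M f i j k)"
proof -
  note tail_head = edge_vertices[OF mesh, of e]
  consider "edge_tail M e = i" "edge_head M e = j" | "edge_tail M e = j" "edge_head M e = i"
    using tail_head e by (auto simp: doubleton_eq_iff)
  then show ?thesis
  proof cases
    case 1
    then show ?thesis
      using curl_mat_eq_sgn[OF mesh, of f e k] f ne by (simp add: grad_mat_def)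
  next
    case 2
    then show ?thesis
      using curl_mat_eq_sgn[OF mesh, of f e k] f ne orient_swap[of M f j i k]
      by (simp add: grad_mat_def insert_commute sgn_minus)
  qed
qed

text \<open>
  At a corner \<open>i\<close> of a triangle exactly two edges meet; one arrives at \<open>i\<close> and the other leaves it
  when the boundary is traversed, which is the antisymmetry of the signed area in the two other
  corners.
\<close>

lemma curl_grad_zero:
  assumes mesh: "delaunay_mesh \<Omega> M"
  shows "curl_mat M ** grad_mat M = 0"
proof -
  have "(\<Sum>e\<in>UNIV. curl_mat M $ f $ e * grad_mat M $ e $ i) = 0" for f i
  proof (cases "i \<in> face M f")
    case False
    have "curl_mat M $ f $ e * grad_mat M $ e $ i = 0" for e
      using False edge_vertices(1)[OF mesh, of e] by (auto simp: curl_mat_def grad_mat_def)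
    then show ?thesis by (intro sum.neutral) blast
  next
    case True
    obtain c where c: "face M f \<subseteq> elem M c" "card (face M f) = 3"
      using face_in_elem[OF mesh] .
    obtain j k where f: "face M f = {i, j, k}" and ne: "i \<noteq> j" "i \<noteq> k" "j \<noteq> k"
      using card_3_with_element[OF c(2) True] .
    have f': "face M f = {i, k, j}"
      using f by auto
    obtain e1 where e1: "edge M e1 = {i, j}"
      using edge_index[OF mesh ne(1)] c(1) f by auto
    obtain e2 where e2: "edge M e2 = {i, k}"
      using edge_index[OF mesh ne(2)] c(1) f by auto
    have "e1 \<noteq> e2"
      using e1 e2 ne by (auto simp: doubleton_eq_iff)
    moreover have "curl_mat M $ f $ e * grad_mat M $ e $ i = 0" if "e \<noteq> e1" "e \<noteq> e2" for e
    proof (rule ccontr)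
      assume "curl_mat M $ f $ e * grad_mat M $ e $ i \<noteq> 0"
      then have sub: "edge M e \<subseteq> {i, j, k}" and "i = edge_tail M e \<or> i = edge_head M e"
        using f by (simp_all add: curl_mat_def grad_mat_def split: if_splits)
      then obtain m where m: "edge M e = {i, m}" "m \<noteq> i"
      proof (elim disjE)
        assume "i = edge_tail M e"
        then show ?thesis
          using that[of "edge_head M e"] edge_vertices[OF mesh, of e] by simp
      next
        assume "i = edge_head M e"
        then show ?thesis
          using that[of "edge_tail M e"] edge_vertices[OF mesh, of e]
          by (simp add: insert_commute)
      qed
      then have "m = j \<or> m = k"
        using sub by blast
      then have "edge M e = edge M e1 \<or> edge M e = edge M e2"
        using m(1) e1 e2 by auto
      then show False
        using that inj_edge[OF mesh] by (metis injD)
    qed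
    ultimately have "(\<Sum>e\<in>UNIV. curl_mat M $ f $ e * grad_mat M $ e $ i)
        = curl_mat M $ f $ e1 * grad_mat M $ e1 $ i + curl_mat M $ f $ e2 * grad_mat M $ e2 $ i"
      by (rule sum_eq_two_terms)
    also have "\<dots> = - sgn (orient M f i j k) - sgn (orient M f i k j)"
      using curl_grad_term[OF mesh f ne e1] curl_grad_term[OF mesh f' _ _ _ e2] ne by simp
    also have "\<dots> = 0"
      using orient_swap'[of M f i k j] by (simp add: sgn_minus)
    finally show ?thesis .
  qed
  then show ?thesis
    by (simp add: matrix_matrix_mult_def vec_eq_iff)
qed

lemma dual_grad_mat_eq_sgn:
  assumes mesh: "delaunay_mesh \<Omega> M"
    and f: "face M f = {a, b, p}" and c: "elem M c = {a, b, p, q}" and q: "q \<notin> face M f"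
  shows "dual_grad_mat \<sigma> M $ f $ c = - \<sigma> * sgn (dual_tangent M f \<bullet> (node M q - node M a))"
proof -
  let ?\<nu> = "dual_tangent M f"
  have \<nu>: "is_unit_normal M f ?\<nu>"
    using mesh by (auto simp: delaunay_mesh_def)
  have base: "?\<nu> \<bullet> (node M q - node M j) = ?\<nu> \<bullet> (node M q - node M a)" if "j \<in> face M f" for j
  proof -
    have "?\<nu> \<bullet> (node M a - node M j) = 0"
      using \<nu> that f unfolding is_unit_normal_def by blast
    then show ?thesis by (simp add: inner_diff_right)
  qed
  have "elem M c - face M f = {q}"
    using c f q by auto
  then have "is_outward_unit_normal M c f ?\<nu> \<longleftrightarrow>
      (\<forall>j\<in>face M f. ?\<nu> \<bullet> (node M q - node M j) < 0)"
    using \<nu> by (simp add: is_outward_unit_normal_def)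
  also have "\<dots> \<longleftrightarrow> ?\<nu> \<bullet> (node M q - node M a) < 0"
    using base f by (metis insertI1)
  finally have "is_outward_unit_normal M c f ?\<nu> \<longleftrightarrow> ?\<nu> \<bullet> (node M q - node M a) < 0" .
  moreover have "?\<nu> \<bullet> (node M q - node M a) \<noteq> 0"
    using elem_triple_product[OF mesh c] orient_times_height[OF mesh, of a b p f "node M q"] f
    by auto
  ultimately show ?thesis
    using c f by (auto simp: dual_grad_mat_def sgn_if)
qed

lemma dual_grad_curl_term:
  assumes mesh: "delaunay_mesh \<Omega> M"
    and f: "face M f = {edge_tail M e, edge_head M e, p}"
    and c: "elem M c = {edge_tail M e, edge_head M e, p, q}"
    and p: "p \<notin> edge M e" and q: "q \<notin> face M f"
  shows "dual_grad_mat \<sigma> M $ f $ c * curl_mat M $ f $ e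
       = - \<sigma> * sgn (cross3 (node M (edge_head M e) - node M (edge_tail M e))
                          (node M p - node M (edge_tail M e))
                   \<bullet> (node M q - node M (edge_tail M e)))"
proof -
  have "p \<noteq> edge_tail M e" "p \<noteq> edge_head M e"
    using p edge_vertices(1)[OF mesh, of e] by auto
  then have "curl_mat M $ f $ e = sgn (orient M f (edge_tail M e) (edge_head M e) p)"
    by (rule curl_mat_eq_sgn[OF mesh f])
  moreover have "{edge_tail M e, edge_head M e, p} \<subseteq> face M f"
    using f by simp
  note orient_times_height[OF mesh this, of "node M q", symmetric]
  ultimately show ?thesis
    by (simp add: dual_grad_mat_eq_sgn[OF mesh f c q] sgn_mult)
qed

text \<open>
  In a tetrahedron an edge lies on exactly two faces. Each contributes, up to a common factor, the
  sign of the volume spanned by the edge and the two remaining vertices, and the two faces list those vertices in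
  opposite order.
\<close>

lemma dual_grad_curl_zero:
  assumes mesh: "delaunay_mesh \<Omega> M"
  shows "transpose (dual_grad_mat \<sigma> M) ** curl_mat M = 0"
proof -
  have "(\<Sum>f\<in>UNIV. dual_grad_mat \<sigma> M $ f $ c * curl_mat M $ f $ e) = 0" for c e
  proof (cases "edge M e \<subseteq> elem M c")
    case False
    then have "dual_grad_mat \<sigma> M $ f $ c * curl_mat M $ f $ e = 0" for f
      by (auto simp: dual_grad_mat_def curl_mat_def)
    then show ?thesis by (intro sum.neutral) blast
  next
    case True
    let ?a = "edge_tail M e" and ?b = "edge_head M e"
    note e = edge_vertices[OF mesh, of e]
    have "card (edge M e) = 2"
      using e by (metis card_2_iff less_imp_neq)
    moreover have "card (elem M c) = 4"
      using mesh by (simp add: delaunay_mesh_def)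
    ultimately have "card (elem M c - edge M e) = 2"
      using True by (simp add: card_Diff_subset)
    then obtain p q where pq: "elem M c - edge M e = {p, q}" "p \<noteq> q"
      by (auto simp: card_2_iff)
    have "elem M c = edge M e \<union> {p, q}"
      using True pq by blast
    then have c: "elem M c = {?a, ?b, p, q}" "elem M c = {?a, ?b, q, p}"
      using e(1) by auto
    have ne: "?a \<noteq> ?b" "p \<notin> edge M e" "q \<notin> edge M e" "p \<noteq> ?a" "p \<noteq> ?b" "q \<noteq> ?a" "q \<noteq> ?b"
      using e pq by auto
    obtain f1 where f1: "face M f1 = {?a, ?b, p}"
      using face_index[OF mesh ne(1), of p c] ne c by auto
    obtain f2 where f2: "face M f2 = {?a, ?b, q}"
      using face_index[OF mesh ne(1), of q c] ne c by auto
    have notin: "q \<notin> face M f1" "p \<notin> face M f2"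
      using f1 f2 ne pq(2) by auto
    have "f1 \<noteq> f2"
      using notin f2 by auto
    moreover have "dual_grad_mat \<sigma> M $ f $ c * curl_mat M $ f $ e = 0"
      if "f \<noteq> f1" "f \<noteq> f2" for f
    proof (rule ccontr)
      assume "dual_grad_mat \<sigma> M $ f $ c * curl_mat M $ f $ e \<noteq> 0"
      then have sub: "edge M e \<subseteq> face M f" "face M f \<subseteq> elem M c"
        by (auto simp: dual_grad_mat_def curl_mat_def split: if_splits)
      have "card (face M f) = 3"
        using face_in_elem[OF mesh] by blast
      then have "card (face M f - edge M e) = 1"
        using sub(1) \<open>card (edge M e) = 2\<close> by (simp add: card_Diff_subset)
      then obtain r where r: "face M f - edge M e = {r}"
        by (auto simp: card_1_singleton_iff)
      then have "r = p \<or> r = q"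
        using sub(2) pq(1) by auto
      moreover have "face M f = edge M e \<union> {r}"
        using r sub(1) by blast
      then have "face M f = {?a, ?b, r}"
        using e(1) by auto
      ultimately have "face M f = face M f1 \<or> face M f = face M f2"
        using f1 f2 by auto
      then show False
        using that inj_face[OF mesh] by (metis injD)
    qed
    ultimately have "(\<Sum>f\<in>UNIV. dual_grad_mat \<sigma> M $ f $ c * curl_mat M $ f $ e)
        = dual_grad_mat \<sigma> M $ f1 $ c * curl_mat M $ f1 $ e
        + dual_grad_mat \<sigma> M $ f2 $ c * curl_mat M $ f2 $ e"
      by (rule sum_eq_two_terms)
    also have "\<dots> = 0"
      unfolding dual_grad_curl_term[OF mesh f1 c(1) ne(2) notin(1)]
        dual_grad_curl_term[OF mesh f2 c(2) ne(3) notin(2)]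
        triple_product_swap[of _ "node M q - node M ?a"]
      by (simp add: sgn_minus)
    finally show ?thesis .
  qed
  then show ?thesis
    by (simp add: matrix_matrix_mult_def transpose_def vec_eq_iff)
qed

section \<open>Positivity of lengths, areas and exponential averages\<close>

text \<open>
  The integrand attains a positive minimum on the compact set, and the box, which bounds the measure
  of the set from below, makes the integral of that minimum positive.
\<close>

lemma set_integral_pos:
  fixes g :: "'a::euclidean_space \<Rightarrow> real"
  assumes K: "compact K" and box: "cbox a b \<subseteq> K" "\<And>i. i \<in> Basis \<Longrightarrow> a \<bullet> i < b \<bullet> i"
    and g: "continuous_on K g" "\<And>x. x \<in> K \<Longrightarrow> g x > 0"
  shows "(LINT x:K|lborel. g x) > 0"
proof -
  have "cbox a b \<noteq> {}"
    unfolding box_ne_empty using box(2) by (blast intro: less_imp_le)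
  then have "K \<noteq> {}"
    using box(1) by auto
  then obtain x0 where x0: "x0 \<in> K" "\<And>x. x \<in> K \<Longrightarrow> g x0 \<le> g x"
    using continuous_attains_inf[OF K _ g(1)] by auto
  have int: "integrable lborel (\<lambda>x. indicator K x *\<^sub>R g x)"
    by (rule borel_integrable_compact[OF K g(1)])
  have int0: "integrable lborel (\<lambda>x. indicator (cbox a b) x *\<^sub>R g x0)"
    by (rule borel_integrable_compact) auto
  have "0 < g x0 * measure lborel (cbox a b)"
    using g(2)[OF x0(1)] box(2) by (simp add: content_pos_lt)
  also have "\<dots> = (\<integral>x. indicator (cbox a b) x *\<^sub>R g x0 \<partial>lborel)"
    by simp
  also have "\<dots> \<le> (\<integral>x. indicator K x *\<^sub>R g x \<partial>lborel)"
    using int0 int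
  proof (rule integral_mono)
    show "indicator (cbox a b) x *\<^sub>R g x0 \<le> indicator K x *\<^sub>R g x" for x
      using box(1) x0 g(2)[of x] by (auto simp: indicator_def less_imp_le)
  qed
  finally show ?thesis
    by (simp add: set_lebesgue_integral_def)
qed

lemma elem_set_subset_closure:
  assumes "delaunay_mesh \<Omega> M"
  shows "elem_set M c \<subseteq> closure \<Omega>"
  using assms unfolding delaunay_mesh_def by blast

lemma edge_integral_pos:
  assumes mesh: "delaunay_mesh \<Omega> M"
    and g: "continuous_on (closure \<Omega>) g" "\<And>x. g x > 0"
  shows "edge_integral M g e > 0"
proof -
  let ?x = "node M (edge_tail M e)" and ?y = "node M (edge_head M e)"
  obtain c where c: "edge M e \<subseteq> elem M c"
    using elem_contains_edge[OF mesh] .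
  have "{?x, ?y} \<subseteq> node M ` elem M c"
    using c edge_vertices(1)[OF mesh, of e] by auto
  then have "closed_segment ?x ?y \<subseteq> elem_set M c"
    unfolding elem_set_def segment_convex_hull by (rule hull_mono)
  then have "linepath ?x ?y ` {0..1} \<subseteq> closure \<Omega>"
    using elem_set_subset_closure[OF mesh, of c] by (auto dest: linepath_in_path[of _ ?x ?y])
  then have "continuous_on {0..1} (\<lambda>t. g (linepath ?x ?y t) * edge_length M e)"
    by (intro continuous_intros continuous_on_compose2[OF g(1)] continuous_on_linepath) auto
  then show ?thesis
    unfolding edge_integral_def
    using g(2) edge_length_pos[OF mesh]
    by (intro set_integral_pos[where a = 0 and b = 1]) auto
qed

lemma face_integral_pos:
  assumes mesh: "delaunay_mesh \<Omega> M"
    and g: "continuous_on (closure \<Omega>) g" "\<And>x. g x > 0"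
  shows "face_integral M g f > 0"
proof -
  obtain c where c: "face M f \<subseteq> elem M c" "card (face M f) = 3"
    using face_in_elem[OF mesh] .
  define l where "l = sorted_list_of_set (face M f)"
  have "length l = 3" "set l = face M f"
    using c(2) by (simp_all add: l_def card_ge_0_finite)
  then have l: "face M f = {l ! 0, l ! 1, l ! 2}"
    by (auto simp: set_conv_nth less_Suc_eq numeral_eq_Suc)
  define a u v where "a = face_vertex M f 0"
    and "u = face_vertex M f 1 - a" and "v = face_vertex M f 2 - a"
  have auv: "a = node M (l ! 0)" "a + u = node M (l ! 1)" "a + v = node M (l ! 2)"
    by (simp_all add: a_def u_def v_def face_vertex_def l_def)
  \<comment> \<open>the parameter triangle of the surface integral; a half-size square inside it witnesses its
    positive measure\<close>
  define T where "T = {(s::real, t::real). 0 \<le> s \<and> 0 \<le> t \<and> s + t \<le> 1}"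
  have closed: "closed T"
    unfolding T_def case_prod_unfold
    by (intro closed_Collect_conj closed_Collect_le continuous_intros)
  have "T \<subseteq> cbox (0, 0) (1, 1)"
    by (auto simp: T_def cbox_Pair_eq)
  with closed have T: "compact T"
    by (metis bounded_cbox bounded_subset compact_eq_bounded_closed)
  have box: "cbox (0, 0) (1/2, 1/2) \<subseteq> T"
    by (auto simp: T_def cbox_Pair_eq)
  have mem: "a + fst x *\<^sub>R u + snd x *\<^sub>R v \<in> closure \<Omega>" if "x \<in> T" for x
  proof -
    have "a + fst x *\<^sub>R u + snd x *\<^sub>R v
        = (1 - fst x - snd x) *\<^sub>R a + fst x *\<^sub>R (a + u) + snd x *\<^sub>R (a + v)"
      by (simp add: algebra_simps)
    also have "\<dots> \<in> convex hull {a, a + u, a + v}"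
      unfolding convex_hull_3 mem_Collect_eq using that
      by (intro exI[of _ "1 - fst x - snd x"] exI[of _ "fst x"] exI[of _ "snd x"])
         (auto simp: T_def)
    also have "convex hull {a, a + u, a + v} \<subseteq> elem_set M c"
      unfolding elem_set_def auv(2,3) unfolding auv(1)
      using c(1) l by (intro hull_mono) auto
    also have "\<dots> \<subseteq> closure \<Omega>"
      by (rule elem_set_subset_closure[OF mesh])
    finally show ?thesis .
  qed
  have "orient M f (l ! 0) (l ! 1) (l ! 2) \<noteq> 0"
    by (rule orient_nonzero[OF mesh l])
  then have cross: "cross3 u v \<noteq> 0"
    unfolding orient_def auv[symmetric] by auto
  have "(LINT x:T|lborel. g (a + fst x *\<^sub>R u + snd x *\<^sub>R v) * norm (cross3 u v)) > 0"
  proof (rule set_integral_pos[OF T box])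
    show "(0, 0) \<bullet> i < (1/2, 1/2) \<bullet> i" if "i \<in> Basis" for i :: "real \<times> real"
      using that by (auto simp: Basis_prod_def)
    show "continuous_on T (\<lambda>x. g (a + fst x *\<^sub>R u + snd x *\<^sub>R v) * norm (cross3 u v))"
      using mem by (intro continuous_intros continuous_on_compose2[OF g(1)]) auto
  qed (use g(2) cross in auto)
  then show ?thesis
    by (simp add: face_integral_def Let_def a_def u_def v_def T_def)
qed

lemma face_area_pos: "delaunay_mesh \<Omega> M \<Longrightarrow> face_area M f > 0"
  unfolding face_area_def by (rule face_integral_pos) auto

section \<open>The flux complex\<close>

lemma flux1_flux0_zero:
  assumes mesh: "delaunay_mesh \<Omega> M" and Ee: "invertible Ee"
  shows "flux1 M Ee Ef ** flux0 M En Ee = 0"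
proof -
  let ?L = "diag_mat (edge_length M)"
  let ?A = "matrix_inv Ef ** matrix_inv (diag_mat (face_area M))"
  have "edge_length M e \<noteq> 0" for e
    using edge_length_pos[OF mesh, of e] by simp
  then have L: "?L ** matrix_inv ?L = mat 1"
    by (intro matrix_mul_matrix_inv invertible_diag_mat)
  have "flux1 M Ee Ef ** flux0 M En Ee
      = ?A ** curl_mat M ** (?L ** (Ee ** matrix_inv Ee) ** matrix_inv ?L) ** grad_mat M ** En"
    by (simp add: flux1_def flux0_def matrix_mul_assoc)
  also have "\<dots> = ?A ** (curl_mat M ** grad_mat M) ** En"
    by (simp add: matrix_mul_matrix_inv[OF Ee] L matrix_mul_assoc)
  finally show ?thesis
    by (simp add: curl_grad_zero[OF mesh])
qed

lemma flux2_flux1_zero: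
  assumes mesh: "delaunay_mesh \<Omega> M" and Ef: "invertible Ef"
  shows "flux2 \<sigma> M Ef Ec ** flux1 M Ee Ef = 0"
proof -
  let ?S = "diag_mat (face_area M)" and ?L = "diag_mat (edge_length M)"
  let ?G = "transpose (dual_grad_mat \<sigma> M)"
  let ?A = "matrix_inv Ec ** matrix_inv (diag_mat (elem_volume M))"
  have "face_area M f \<noteq> 0" for f
    using face_area_pos[OF mesh, of f] by simp
  then have S: "?S ** matrix_inv ?S = mat 1"
    by (intro matrix_mul_matrix_inv invertible_diag_mat)
  have "flux2 \<sigma> M Ef Ec ** flux1 M Ee Ef
      = ?A ** ?G ** (?S ** (Ef ** matrix_inv Ef) ** matrix_inv ?S) ** curl_mat M ** ?L ** Ee"
    by (simp add: flux2_def flux1_def matrix_mul_assoc)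
  also have "\<dots> = ?A ** (?G ** curl_mat M) ** ?L ** Ee"
    by (simp add: matrix_mul_matrix_inv[OF Ef] S matrix_mul_assoc)
  finally show ?thesis
    by (simp add: dual_grad_curl_zero[OF mesh])
qed

theorem mainTheorem5:
  fixes M :: "('n::{finite,linorder}, 'e::finite, 'f::finite, 'c::finite) mesh"
    and \<Omega> :: "(real^3) set"
    and \<alpha> :: "real^3 \<Rightarrow> real" and \<beta> :: "real^3 \<Rightarrow> real^3" and \<phi> :: "real^3 \<Rightarrow> real"
    and \<sigma> :: real
  assumes mesh: "delaunay_mesh \<Omega> M"
    and sign: "\<sigma> \<in> {1, -1}"
    and diffusion: "\<And>y. y \<in> \<Omega> \<Longrightarrow> \<alpha> y > 0"
    and potential: "\<And>y. y \<in> \<Omega> \<Longrightarrow> GDERIV \<phi> y :> (\<beta> y /\<^sub>R \<alpha> y)"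
    and cont: "continuous_on (closure \<Omega>) \<phi>"
  shows
    "(flux1 M (E_edge M \<phi>) (E_face M \<phi>) ** flux0 M (E_node M \<phi>) (E_edge M \<phi>) = 0 \<and>
      flux2 \<sigma> M (E_face M \<phi>) (E_elem M \<phi>) ** flux1 M (E_edge M \<phi>) (E_face M \<phi>) = 0) \<and>
     (\<forall>(de :: 'e \<Rightarrow> real) (df :: 'f \<Rightarrow> real) (dc :: 'c \<Rightarrow> real).
        invertible (diag_mat de) \<and> invertible (diag_mat df) \<and> invertible (diag_mat dc) \<longrightarrow>
          flux1 M (diag_mat de) (diag_mat df) ** flux0 M (E_node M \<phi>) (diag_mat de) = 0 \<and>
          flux2 \<sigma> M (diag_mat df) (diag_mat dc) ** flux1 M (diag_mat de) (diag_mat df) = 0)"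
proof (intro conjI allI impI; (elim conjE)?)
  have exp: "continuous_on (closure \<Omega>) (\<lambda>y. exp (\<phi> y))"
    using cont by (intro continuous_intros)
  have "edge_average M (\<lambda>y. exp (\<phi> y)) e \<noteq> 0" for e
    using edge_integral_pos[OF mesh exp, of e] edge_length_pos[OF mesh, of e]
    by (simp add: edge_average_def)
  then have Ee: "invertible (E_edge M \<phi>)"
    unfolding E_edge_def by (rule invertible_diag_mat)
  have "face_average M (\<lambda>y. exp (\<phi> y)) f \<noteq> 0" for f
    using face_integral_pos[OF mesh exp, of f] face_area_pos[OF mesh, of f]
    by (simp add: face_average_def)
  then have Ef: "invertible (E_face M \<phi>)"
    unfolding E_face_def by (rule invertible_diag_mat)
  show "flux1 M (E_edge M \<phi>) (E_face M \<phi>) ** flux0 M (E_node M \<phi>) (E_edge M \<phi>) = 0"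
    by (rule flux1_flux0_zero[OF mesh Ee])
  show "flux2 \<sigma> M (E_face M \<phi>) (E_elem M \<phi>) ** flux1 M (E_edge M \<phi>) (E_face M \<phi>) = 0"
    by (rule flux2_flux1_zero[OF mesh Ef])
next
  fix de :: "'e \<Rightarrow> real" and df :: "'f \<Rightarrow> real" and dc :: "'c \<Rightarrow> real"
  assume de: "invertible (diag_mat de)" and df: "invertible (diag_mat df)"
  show "flux1 M (diag_mat de) (diag_mat df) ** flux0 M (E_node M \<phi>) (diag_mat de) = 0"
    by (rule flux1_flux0_zero[OF mesh de])
  show "flux2 \<sigma> M (diag_mat df) (diag_mat dc) ** flux1 M (diag_mat de) (diag_mat df) = 0"
    by (rule flux2_flux1_zero[OF mesh df])
qed

end
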